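(* For an episode of length $H$ and two (non-stationary) policies $\boldsymbol\pi$ and $\boldsymbol\pi'$, the difference in their performance, assuming identical initial state distribution $\mu$ (i.e., $s_1\sim\mu$), is $$J(\boldsymbol\pi)-J(\boldsymbol\pi')=\sum_{h=1}^{H}\ \mathbb{E}_{\,s_1\sim\mu,\ (s_h,a_h)\sim\mathbb{P}^{\boldsymbol\pi}_h(\cdot,\cdot\mid s_1)}\big[A^{\boldsymbol\pi'}_h(s_h,a_h)\big].$$
   Context: A fixed-horizon MDP is a tuple $(S,A,r,P,\mu,H)$ with states $S$, actions $A$, reward $r:S\times A\times S\to\mathbb{R}$, transition probabilities $P(s'|s,a)$, initial distribution $\mu$ and horizon $H$. A policy is a sequence $\boldsymbol\pi=(\pi_h)_{h=1}^{H}$, each $\pi_h$ mapping states to probability distributions on $A$. A trajectory $\tau\sim\boldsymbol\pi$ is generated by $s_1\sim\mu$, $a_h\sim\pi_h(\cdot|s_h)$, $s_{h+1}\sim P(\cdot|s_h,a_h)$. The performance is $J(\boldsymbol\pi)=\mathbb{E}_{\tau\sim\boldsymbol\pi}\big[\sum_{h=1}^{H}r(s_h,a_h,s_{h+1})\big]$. With $R_{h:H}(\tau)$ the total reward of the trajectory from time $h$ until the end of the episode, $V_h^{\boldsymbol\pi}(s)=\mathbb{E}_{\tau\sim\boldsymbol\pi}[R_{h:H}(\tau)\mid s_h=s]$, $Q_h^{\boldsymbol\pi}(s,a)=\mathbb{E}_{\tau\sim\boldsymbol\pi}[R_{h:H}(\tau)\mid s_h=s,a_h=a]$, and $A_h^{\boldsymbol\pi}(s,a)=Q_h^{\boldsymbol\pi}(s,a)-V_h^{\boldsymbol\pi}(s)$.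 $\mathbb{P}^{\boldsymbol\pi}_h(s,a\mid s_1)$ is the probability of reaching $(s,a)$ at time step $h$ when following $\boldsymbol\pi$ from $s_1$. *)

theory Defs
  imports "HOL-Probability.Probability"
begin

text \<open>
  States and actions are arbitrary types and all laws are discrete (\<^typ>\<open>'b pmf\<close>), so
  \<open>trans M s a\<close> is the law \<open>P(\<cdot>|s,a)\<close>.
\<close>

record ('s, 'a) mdp =
  reward :: "'s \<Rightarrow> 'a \<Rightarrow> 's \<Rightarrow> real"
  trans :: "'s \<Rightarrow> 'a \<Rightarrow> 's pmf"
  init :: "'s pmf"
  horizon :: nat

text \<open>Time steps are numbered from 1; only the values of a policy at \<open>1, \<dots>, horizon M\<close> matter.\<close>

type_synonym ('s, 'a) policy = "nat \<Rightarrow> 's \<Rightarrow> 'a pmf"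

text \<open>A trajectory \<open>s\<^sub>1, a\<^sub>1, \<dots>, s\<^sub>H, a\<^sub>H, s\<^sub>H\<^sub>+\<^sub>1\<close> is the list of its transitions
  \<open>(s\<^sub>h, a\<^sub>h, s\<^sub>h\<^sub>+\<^sub>1)\<close>.\<close>

type_synonym ('s, 'a) traj = "('s \<times> 'a \<times> 's) list"

definition state_at :: "('s, 'a) traj \<Rightarrow> nat \<Rightarrow> 's" where
  "state_at \<tau> h = fst (\<tau> ! (h - 1))"

definition action_at :: "('s, 'a) traj \<Rightarrow> nat \<Rightarrow> 'a" where
  "action_at \<tau> h = fst (snd (\<tau> ! (h - 1)))"

definition total_reward :: "('s, 'a) mdp \<Rightarrow> ('s, 'a) traj \<Rightarrow> real" where
  "total_reward M \<tau> = (\<Sum>(s, a, s')\<leftarrow>\<tau>. reward M s a s')"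

text \<open>\<open>R\<^sub>h\<^sub>:\<^sub>H(\<tau>)\<close> for a full trajectory \<open>\<tau>\<close>.\<close>

definition reward_to_go :: "('s, 'a) mdp \<Rightarrow> nat \<Rightarrow> ('s, 'a) traj \<Rightarrow> real" where
  "reward_to_go M h \<tau> = total_reward M (drop (h - 1) \<tau>)"

text \<open>The law of the next \<open>n\<close> transitions when the process is in state \<open>s\<close> at time \<open>h\<close>.\<close>

primrec run :: "('s, 'a) mdp \<Rightarrow> ('s, 'a) policy \<Rightarrow> nat \<Rightarrow> nat \<Rightarrow> 's \<Rightarrow> ('s, 'a) traj pmf" where
  "run M \<pi> 0 h s = return_pmf []"
| "run M \<pi> (Suc n) h s =
     bind_pmf (\<pi> h s) (\<lambda>a. bind_pmf (trans M s a) (\<lambda>s'.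
       map_pmf (\<lambda>\<tau>. (s, a, s') # \<tau>) (run M \<pi> n (Suc h) s')))"

definition trajectory_from :: "('s, 'a) mdp \<Rightarrow> ('s, 'a) policy \<Rightarrow> 's \<Rightarrow> ('s, 'a) traj pmf" where
  "trajectory_from M \<pi> s\<^sub>1 = run M \<pi> (horizon M) 1 s\<^sub>1"

definition trajectory :: "('s, 'a) mdp \<Rightarrow> ('s, 'a) policy \<Rightarrow> ('s, 'a) traj pmf" where
  "trajectory M \<pi> = bind_pmf (init M) (trajectory_from M \<pi>)"

definition performance :: "('s, 'a) mdp \<Rightarrow> ('s, 'a) policy \<Rightarrow> real" where
  "performance M \<pi> = measure_pmf.expectation (trajectory M \<pi>) (total_reward M)"

text \<open>
  The conditioning on \<open>s\<^sub>h = s\<close> (and \<open>a\<^sub>h = a\<close>) is done by restarting the process at time \<open>h\<close>, so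
  that it makes sense also when \<open>\<pi>\<close> itself never reaches \<open>s\<close> at time \<open>h\<close>. Lemmas
  \<open>tail_law_cond\<close> and \<open>action_tail_law_cond\<close> below show that these laws are the elementary
  conditional laws whenever the conditioning event has positive probability.
\<close>

definition tail_law :: "('s, 'a) mdp \<Rightarrow> ('s, 'a) policy \<Rightarrow> nat \<Rightarrow> 's \<Rightarrow> ('s, 'a) traj pmf" where
  "tail_law M \<pi> h s = run M \<pi> (Suc (horizon M) - h) h s"

definition action_tail_law ::
    "('s, 'a) mdp \<Rightarrow> ('s, 'a) policy \<Rightarrow> nat \<Rightarrow> 's \<Rightarrow> 'a \<Rightarrow> ('s, 'a) traj pmf" where
  "action_tail_law M \<pi> h s a =
     bind_pmf (trans M s a) (\<lambda>s'. map_pmf (\<lambda>\<tau>. (s, a, s') # \<tau>) (tail_law M \<pi> (Suc h) s'))"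

definition state_value :: "('s, 'a) mdp \<Rightarrow> ('s, 'a) policy \<Rightarrow> nat \<Rightarrow> 's \<Rightarrow> real" where
  "state_value M \<pi> h s = measure_pmf.expectation (tail_law M \<pi> h s) (total_reward M)"

definition action_value :: "('s, 'a) mdp \<Rightarrow> ('s, 'a) policy \<Rightarrow> nat \<Rightarrow> 's \<Rightarrow> 'a \<Rightarrow> real" where
  "action_value M \<pi> h s a = measure_pmf.expectation (action_tail_law M \<pi> h s a) (total_reward M)"

definition advantage :: "('s, 'a) mdp \<Rightarrow> ('s, 'a) policy \<Rightarrow> nat \<Rightarrow> 's \<Rightarrow> 'a \<Rightarrow> real" where
  "advantage M \<pi> h s a = action_value M \<pi> h s a - state_value M \<pi> h s"

text \<open>\<open>\<P>\<^sup>\<pi>\<^sub>h(\<cdot>, \<cdot> | s\<^sub>1)\<close>, the law of \<open>(s\<^sub>h, a\<^sub>h)\<close> for the process started in \<open>s\<^sub>1\<close>.\<close>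

definition visit :: "('s, 'a) mdp \<Rightarrow> ('s, 'a) policy \<Rightarrow> nat \<Rightarrow> 's \<Rightarrow> ('s \<times> 'a) pmf" where
  "visit M \<pi> h s\<^sub>1 = map_pmf (\<lambda>\<tau>. (state_at \<tau> h, action_at \<tau> h)) (trajectory_from M \<pi> s\<^sub>1)"

subsection \<open>Agreement with elementary conditioning\<close>

lemma map_cond_pmf_kernel:
  assumes X: "map_pmf (\<lambda>x. (g x, f x)) X = bind_pmf D (\<lambda>t. map_pmf (\<lambda>y. (y, t)) (K t))"
    and s: "s \<in> f ` set_pmf X"
  shows "map_pmf g (cond_pmf X {x. f x = s}) = K s"
proof (rule pmf_eqI)
  fix y
  have ne: "set_pmf X \<inter> {x. f x = s} \<noteq> {}" using s by auto
  have "map_pmf f X = map_pmf snd (map_pmf (\<lambda>x. (g x, f x)) X)"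
    by (simp add: pmf.map_comp o_def)
  also have "\<dots> = D"
    unfolding X by (simp add: map_bind_pmf pmf.map_comp o_def map_pmf_const bind_return_pmf')
  finally have D: "map_pmf f X = D" .
  have pD: "measure (measure_pmf X) {x. f x = s} = pmf D s"
    unfolding D[symmetric] by (simp add: pmf_map vimage_def)
  have pos: "pmf D s \<noteq> 0"
    using s unfolding D[symmetric] by (simp flip: set_pmf_iff)
  have k: "pmf (map_pmf (\<lambda>y. (y, t)) (K t)) (y, s) = indicator {s} t * pmf (K s) y" for t
  proof (cases "t = s")
    case True
    then show ?thesis
      using pmf_map_inj'[of "\<lambda>y. (y, s)" "K s" y] by (simp add: inj_on_def)
  next
    case False
    then show ?thesis by (auto simp: pmf_eq_0_set_pmf)
  qed
  have "pmf (map_pmf (\<lambda>x. (g x, f x)) X) (y, s) = pmf D s * pmf (K s) y"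
    unfolding X by (simp add: pmf_bind k measure_pmf_single)
  then have j: "measure (measure_pmf X) {x. g x = y \<and> f x = s} = pmf D s * pmf (K s) y"
    by (simp add: pmf_map vimage_def)
  have "pmf (map_pmf g (cond_pmf X {x. f x = s})) y
      = measure (measure_pmf (cond_pmf X {x. f x = s})) {x. g x = y}"
    by (simp add: pmf_map vimage_def)
  also have "\<dots> = measure (measure_pmf X) {x. g x = y \<and> f x = s}
      / measure (measure_pmf X) {x. f x = s}"
    unfolding cond_pmf.rep_eq[OF ne]
    by (subst measure_uniform_measure)
       (simp_all add: emeasure_measure_pmf_not_zero[OF ne] Int_def conj_commute)
  also have "\<dots> = pmf (K s) y" using pos by (simp add: pD j)
  finally show "pmf (map_pmf g (cond_pmf X {x. f x = s})) y = pmf (K s) y" .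
qed

primrec state_after :: "('s, 'a) mdp \<Rightarrow> ('s, 'a) policy \<Rightarrow> nat \<Rightarrow> nat \<Rightarrow> 's \<Rightarrow> 's pmf" where
  "state_after M \<pi> 0 h s = return_pmf s"
| "state_after M \<pi> (Suc n) h s =
     bind_pmf (\<pi> h s) (\<lambda>a. bind_pmf (trans M s a) (state_after M \<pi> n (Suc h)))"

lemma map_drop_run:
  "map_pmf (drop m) (run M \<pi> (m + n) h s) = bind_pmf (state_after M \<pi> m h s) (run M \<pi> n (h + m))"
  by (induction m arbitrary: h s)
     (simp_all add: map_bind_pmf bind_assoc_pmf bind_return_pmf pmf.map_comp o_def map_pmf_id[unfolded id_def])

lemma run_start:
  "\<tau> \<in> set_pmf (run M \<pi> (Suc n) h s) \<Longrightarrow> fst (hd \<tau>) = s"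
  by auto

lemma length_run: "\<tau> \<in> set_pmf (run M \<pi> n h s) \<Longrightarrow> length \<tau> = n"
  by (induction n arbitrary: \<tau> h s) auto

lemma map_drop_trajectory:
  assumes "1 \<le> h" "h \<le> horizon M"
  shows "map_pmf (drop (h - 1)) (trajectory M \<pi>) =
    bind_pmf (bind_pmf (init M) (state_after M \<pi> (h - 1) 1)) (tail_law M \<pi> h)"
proof -
  have "horizon M = (h - 1) + (Suc (horizon M) - h)" using assms by simp
  then have "map_pmf (drop (h - 1)) (run M \<pi> (horizon M) 1 s)
    = bind_pmf (state_after M \<pi> (h - 1) 1 s) (run M \<pi> (Suc (horizon M) - h) (1 + (h - 1)))" for s
    using map_drop_run[of "h - 1" M \<pi> "Suc (horizon M) - h" 1 s] by simp
  moreover have "1 + (h - 1) = h" using assms by simp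
  moreover have "tail_law M \<pi> h = run M \<pi> (Suc (horizon M) - h) h"
    by (rule ext) (simp add: tail_law_def)
  ultimately show ?thesis
    by (simp add: trajectory_def trajectory_from_def map_bind_pmf bind_assoc_pmf
        del: One_nat_def)
qed

lemma trajectory_nth:
  assumes "1 \<le> h" "h \<le> horizon M" "\<tau> \<in> set_pmf (trajectory M \<pi>)"
  shows "\<tau> ! (h - 1) = hd (drop (h - 1) \<tau>)"
proof -
  have "length \<tau> = horizon M"
    using assms(3) by (auto simp: trajectory_def trajectory_from_def length_run)
  then show ?thesis using assms by (simp add: hd_drop_conv_nth)
qed

theorem tail_law_cond:
  assumes h: "1 \<le> h" "h \<le> horizon M"
    and s: "s \<in> (\<lambda>\<tau>. state_at \<tau> h) ` set_pmf (trajectory M \<pi>)"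
  shows "map_pmf (drop (h - 1)) (cond_pmf (trajectory M \<pi>) {\<tau>. state_at \<tau> h = s})
    = tail_law M \<pi> h s"
proof (rule map_cond_pmf_kernel[OF _ s])
  let ?D = "bind_pmf (init M) (state_after M \<pi> (h - 1) 1)"
  have n: "Suc (horizon M) - h = Suc (horizon M - h)" using h by simp
  have "map_pmf (\<lambda>\<tau>. (drop (h - 1) \<tau>, state_at \<tau> h)) (trajectory M \<pi>)
    = map_pmf (\<lambda>\<tau>. (\<tau>, fst (hd \<tau>))) (map_pmf (drop (h - 1)) (trajectory M \<pi>))"
    unfolding pmf.map_comp
    by (rule map_pmf_cong) (simp_all add: o_def state_at_def trajectory_nth[OF h] del: One_nat_def)
  also have "\<dots> = bind_pmf ?D (\<lambda>t. map_pmf (\<lambda>\<tau>. (\<tau>, fst (hd \<tau>))) (tail_law M \<pi> h t))"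
    unfolding map_drop_trajectory[OF h] by (simp add: map_bind_pmf)
  also have "\<dots> = bind_pmf ?D (\<lambda>t. map_pmf (\<lambda>\<tau>. (\<tau>, t)) (tail_law M \<pi> h t))"
    by (intro bind_pmf_cong refl map_pmf_cong) (metis n run_start tail_law_def)
  finally show "map_pmf (\<lambda>\<tau>. (drop (h - 1) \<tau>, state_at \<tau> h)) (trajectory M \<pi>)
    = bind_pmf ?D (\<lambda>t. map_pmf (\<lambda>\<tau>. (\<tau>, t)) (tail_law M \<pi> h t))" .
qed

theorem action_tail_law_cond:
  assumes h: "1 \<le> h" "h \<le> horizon M"
    and sa: "(s, a) \<in> (\<lambda>\<tau>. (state_at \<tau> h, action_at \<tau> h)) ` set_pmf (trajectory M \<pi>)"
  shows "map_pmf (drop (h - 1))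
      (cond_pmf (trajectory M \<pi>) {\<tau>. (state_at \<tau> h, action_at \<tau> h) = (s, a)})
    = action_tail_law M \<pi> h s a"
proof -
  let ?D = "bind_pmf (init M) (state_after M \<pi> (h - 1) 1)"
  let ?D' = "bind_pmf ?D (\<lambda>t. map_pmf (\<lambda>b. (t, b)) (\<pi> h t))"
  let ?f = "\<lambda>\<tau> :: ('a, 'b) traj. (fst (hd \<tau>), fst (snd (hd \<tau>)))"
  have n: "Suc (horizon M) - h = Suc (horizon M - h)" using h by simp
  have t: "tail_law M \<pi> h t = bind_pmf (\<pi> h t) (action_tail_law M \<pi> h t)" for t
    unfolding tail_law_def n action_tail_law_def by simp
  have f: "map_pmf (\<lambda>\<tau>. (\<tau>, ?f \<tau>)) (action_tail_law M \<pi> h t b)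
    = map_pmf (\<lambda>\<tau>. (\<tau>, t, b)) (action_tail_law M \<pi> h t b)" for t b
    by (rule map_pmf_cong) (auto simp: action_tail_law_def)
  have "map_pmf (\<lambda>\<tau>. (drop (h - 1) \<tau>, state_at \<tau> h, action_at \<tau> h)) (trajectory M \<pi>)
    = map_pmf (\<lambda>\<tau>. (\<tau>, ?f \<tau>)) (map_pmf (drop (h - 1)) (trajectory M \<pi>))"
    unfolding pmf.map_comp
    by (rule map_pmf_cong)
       (simp_all add: o_def state_at_def action_at_def trajectory_nth[OF h] del: One_nat_def)
  also have "\<dots> = bind_pmf ?D' (\<lambda>(t, b). map_pmf (\<lambda>\<tau>. (\<tau>, t, b)) (action_tail_law M \<pi> h t b))"
    unfolding map_drop_trajectory[OF h]
    by (simp add: map_bind_pmf t f bind_assoc_pmf bind_map_pmf)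
  finally have "map_pmf (\<lambda>\<tau>. (drop (h - 1) \<tau>, state_at \<tau> h, action_at \<tau> h)) (trajectory M \<pi>)
    = bind_pmf ?D' (\<lambda>tb. map_pmf (\<lambda>\<tau>. (\<tau>, tb)) (case_prod (action_tail_law M \<pi> h) tb))"
    by (simp only: case_prod_unfold prod.collapse)
  from map_cond_pmf_kernel[OF this sa] show ?thesis by simp
qed

corollary state_value_cond:
  assumes "1 \<le> h" "h \<le> horizon M"
    and "s \<in> (\<lambda>\<tau>. state_at \<tau> h) ` set_pmf (trajectory M \<pi>)"
  shows "state_value M \<pi> h s = measure_pmf.expectation
    (cond_pmf (trajectory M \<pi>) {\<tau>. state_at \<tau> h = s}) (reward_to_go M h)"
  unfolding state_value_def tail_law_cond[OF assms, symmetric]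
  by (simp add: reward_to_go_def[abs_def])

corollary action_value_cond:
  assumes "1 \<le> h" "h \<le> horizon M"
    and "(s, a) \<in> (\<lambda>\<tau>. (state_at \<tau> h, action_at \<tau> h)) ` set_pmf (trajectory M \<pi>)"
  shows "action_value M \<pi> h s a = measure_pmf.expectation
    (cond_pmf (trajectory M \<pi>) {\<tau>. state_at \<tau> h = s \<and> action_at \<tau> h = a}) (reward_to_go M h)"
  using action_tail_law_cond[OF assms, symmetric]
  by (simp add: action_value_def reward_to_go_def[abs_def])

subsection \<open>Existence of the expected return\<close>

lemma integrable_total_reward:
  assumes B: "\<And>s a s'. \<bar>reward M s a s'\<bar> \<le> B"
  shows "integrable (measure_pmf (trajectory M \<pi>)) (total_reward M)"
proof (rule measure_pmf.integrable_const_bound)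
  have b: "\<bar>total_reward M \<tau>\<bar> \<le> real (length \<tau>) * B" for \<tau>
  proof (induction \<tau>)
    case (Cons x \<tau>)
    obtain s a s' where x: "x = (s, a, s')" by (cases x)
    show ?case using Cons B[of s a s'] by (simp add: x total_reward_def algebra_simps)
  qed (simp add: total_reward_def)
  have "norm (total_reward M \<tau>) \<le> real (horizon M) * B" if "\<tau> \<in> set_pmf (trajectory M \<pi>)" for \<tau>
  proof -
    have "length \<tau> = horizon M"
      using that by (auto simp: trajectory_def trajectory_from_def length_run)
    then show ?thesis using b[of \<tau>] by simp
  qed
  then show "AE \<tau> in measure_pmf (trajectory M \<pi>). norm (total_reward M \<tau>) \<le> real (horizon M) * B"
    by (simp add: AE_measure_pmf_iff)
qed simp

corollary integrable_total_reward_finite: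
  fixes M :: "('s::finite, 'a::finite) mdp"
  shows "integrable (measure_pmf (trajectory M \<pi>)) (total_reward M)"
proof (rule integrable_total_reward)
  fix s a s'
  show "\<bar>reward M s a s'\<bar> \<le> Max (range (\<lambda>(s, a, s'). \<bar>reward M s a s'\<bar>))"
    by (rule Max_ge) (auto intro!: image_eqI[of _ _ "(s, a, s')"])
qed

end

theory Submission
  imports Defs
begin

text \<open>
  Let \<open>\<rho>\<^sub>k\<close> follow \<open>\<pi>\<close> up to time \<open>k\<close> and \<open>\<pi>'\<close> afterwards. Given the reward \<open>c\<close> collected before
  time \<open>h\<close>, the state \<open>s\<close> at time \<open>h\<close> and the action \<open>a\<close> drawn by \<open>\<pi>\<close>, the conditional expected
  return is \<open>c + Q(s, a)\<close> under \<open>\<rho>\<^sub>h\<close> and \<open>c + V(s)\<close> under \<open>\<rho>\<^sub>h\<^sub>-\<^sub>1\<close>, with the value functions of \<open>\<pi>'\<close> at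
  time \<open>h\<close>. Their difference is the advantage, and the sum over \<open>h\<close> telescopes. For unbounded rewards
  the single terms need not be integrable on their own, so the past reward \<open>c\<close> has to be kept
  until the two returns have been subtracted.
\<close>

subsection \<open>Iterated expectations\<close>

text \<open>This is Tonelli for a discrete kernel: the nonnegative integral over the bind is
  iterated, and its finiteness forces the inner ones to be finite almost everywhere, which for a pmf
  means on its whole support.\<close>

lemma bind_pmf_iterated_expectation_nonneg:
  fixes f :: "'b \<Rightarrow> real"
  assumes f: "integrable (measure_pmf (bind_pmf p K)) f" and nonneg: "\<And>y. 0 \<le> f y"
  shows "x \<in> set_pmf p \<Longrightarrow> integrable (measure_pmf (K x)) f"
    and "integrable (measure_pmf p) (\<lambda>x. measure_pmf.expectation (K x) f)"
    and "measure_pmf.expectation (bind_pmf p K) f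
      = measure_pmf.expectation p (\<lambda>x. measure_pmf.expectation (K x) f)"
proof -
  have eq: "(\<integral>\<^sup>+x. \<integral>\<^sup>+y. f y \<partial>K x \<partial>p) = ennreal (measure_pmf.expectation (bind_pmf p K) f)"
    using nn_integral_eq_integral[OF f] nonneg by simp
  then have "(\<integral>\<^sup>+x. \<integral>\<^sup>+y. f y \<partial>K x \<partial>p) \<noteq> \<infinity>" by simp
  from nn_integral_PInf_AE[OF _ this]
  have fin: "(\<integral>\<^sup>+y. f y \<partial>K x) \<noteq> \<infinity>" if "x \<in> set_pmf p" for x
    using that by (simp add: AE_measure_pmf_iff)
  have int: "integrable (measure_pmf (K x)) f" if "x \<in> set_pmf p" for x
    using fin[OF that] nonneg by (simp add: integrable_iff_bounded less_top)
  then show "x \<in> set_pmf p \<Longrightarrow> integrable (measure_pmf (K x)) f" .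
  have "(\<integral>\<^sup>+x. measure_pmf.expectation (K x) f \<partial>p) = (\<integral>\<^sup>+x. \<integral>\<^sup>+y. f y \<partial>K x \<partial>p)"
    by (rule nn_integral_cong_AE)
       (use int nonneg in \<open>simp add: AE_measure_pmf_iff nn_integral_eq_integral\<close>)
  then have eq': "(\<integral>\<^sup>+x. measure_pmf.expectation (K x) f \<partial>p)
      = ennreal (measure_pmf.expectation (bind_pmf p K) f)"
    unfolding eq .
  show "integrable (measure_pmf p) (\<lambda>x. measure_pmf.expectation (K x) f)"
    by (rule integrableI_nn_integral_finite[OF _ _ eq']) (simp_all add: nonneg)
  show "measure_pmf.expectation (bind_pmf p K) f
      = measure_pmf.expectation p (\<lambda>x. measure_pmf.expectation (K x) f)"
    by (subst (2) integral_eq_nn_integral) (simp_all add: nonneg eq')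
qed

text \<open>Split \<open>f\<close> into positive and negative parts. The split of the inner
  expectation holds only on the support of \<open>p\<close>, so it is transferred by
  almost-everywhere congruence.\<close>

lemma bind_pmf_iterated_expectation:
  fixes f :: "'b \<Rightarrow> real"
  assumes f: "integrable (measure_pmf (bind_pmf p K)) f"
  shows "x \<in> set_pmf p \<Longrightarrow> integrable (measure_pmf (K x)) f"
    and "integrable (measure_pmf p) (\<lambda>x. measure_pmf.expectation (K x) f)"
    and "measure_pmf.expectation (bind_pmf p K) f
      = measure_pmf.expectation p (\<lambda>x. measure_pmf.expectation (K x) f)"
proof -
  let ?pos = "\<lambda>y. max 0 (f y)" and ?neg = "\<lambda>y. max 0 (- f y)"
  have dec: "f = (\<lambda>y. ?pos y - ?neg y)" by (auto simp: fun_eq_iff)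
  have "integrable (measure_pmf (bind_pmf p K)) ?pos" "integrable (measure_pmf (bind_pmf p K)) ?neg"
    using f by auto
  note pos = bind_pmf_iterated_expectation_nonneg[OF this(1)]
    and neg = bind_pmf_iterated_expectation_nonneg[OF this(2)] and int = this
  show "x \<in> set_pmf p \<Longrightarrow> integrable (measure_pmf (K x)) f"
    by (subst dec, rule Bochner_Integration.integrable_diff) (auto intro: pos(1) neg(1))
  have E: "measure_pmf.expectation (K x) f
      = measure_pmf.expectation (K x) ?pos - measure_pmf.expectation (K x) ?neg"
    if "x \<in> set_pmf p" for x
    by (subst dec, rule Bochner_Integration.integral_diff) (use that pos neg in auto)
  have "integrable (measure_pmf p) (\<lambda>x. measure_pmf.expectation (K x) f) \<longleftrightarrow>
      integrable (measure_pmf p)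
        (\<lambda>x. measure_pmf.expectation (K x) ?pos - measure_pmf.expectation (K x) ?neg)"
    by (rule integrable_cong_AE) (simp_all add: AE_measure_pmf_iff E)
  then show "integrable (measure_pmf p) (\<lambda>x. measure_pmf.expectation (K x) f)"
    using pos(2) neg(2) by simp
  have "measure_pmf.expectation (bind_pmf p K) f
      = measure_pmf.expectation (bind_pmf p K) ?pos - measure_pmf.expectation (bind_pmf p K) ?neg"
    by (subst dec, rule Bochner_Integration.integral_diff[OF int])
  also have "\<dots> = measure_pmf.expectation p
      (\<lambda>x. measure_pmf.expectation (K x) ?pos - measure_pmf.expectation (K x) ?neg)"
    using pos(2,3) neg(2,3) by simp
  also have "\<dots> = measure_pmf.expectation p (\<lambda>x. measure_pmf.expectation (K x) f)"
    by (rule integral_cong_AE) (simp_all add: AE_measure_pmf_iff E)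
  finally show "measure_pmf.expectation (bind_pmf p K) f
      = measure_pmf.expectation p (\<lambda>x. measure_pmf.expectation (K x) f)" .
qed

text \<open>Here \<open>c\<close> plays the past reward. Given \<open>x\<close> it is a constant and
  leaves the inner expectation, but \<open>c\<close> itself need not be integrable under
  \<open>p\<close>, so it stays inside the outer one.\<close>

lemma expectation_bind_shift:
  fixes c :: "'a \<Rightarrow> real" and f :: "'b \<Rightarrow> real"
  assumes "integrable (measure_pmf (bind_pmf p (\<lambda>x. map_pmf (\<lambda>y. c x + f y) (K x)))) (\<lambda>z. z)"
  shows "integrable (measure_pmf p) (\<lambda>x. c x + measure_pmf.expectation (K x) f)"
    and "measure_pmf.expectation (bind_pmf p (\<lambda>x. map_pmf (\<lambda>y. c x + f y) (K x))) (\<lambda>z. z)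
      = measure_pmf.expectation p (\<lambda>x. c x + measure_pmf.expectation (K x) f)"
proof -
  note iter = bind_pmf_iterated_expectation[OF assms]
  have E: "measure_pmf.expectation (map_pmf (\<lambda>y. c x + f y) (K x)) (\<lambda>z. z)
      = c x + measure_pmf.expectation (K x) f" if "x \<in> set_pmf p" for x
  proof -
    have "integrable (measure_pmf (K x)) (\<lambda>y. c x + f y)"
      using iter(1)[OF that] by simp
    \<comment> \<open>Subtracting the constant \<open>c x\<close> shows that \<open>f\<close> alone
      is integrable under \<open>K x\<close>, which justifies linearity.\<close>
    then have "integrable (measure_pmf (K x)) (\<lambda>y. (c x + f y) - c x)"
      by (rule Bochner_Integration.integrable_diff) simp
    then show ?thesis by simp
  qed
  have "integrable (measure_pmf p) (\<lambda>x. c x + measure_pmf.expectation (K x) f) \<longleftrightarrow>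
    integrable (measure_pmf p)
      (\<lambda>x. measure_pmf.expectation (map_pmf (\<lambda>y. c x + f y) (K x)) (\<lambda>z. z))"
    by (rule integrable_cong_AE) (simp_all add: AE_measure_pmf_iff E del: integral_map_pmf)
  then show "integrable (measure_pmf p) (\<lambda>x. c x + measure_pmf.expectation (K x) f)"
    using iter(2) by simp
  show "measure_pmf.expectation (bind_pmf p (\<lambda>x. map_pmf (\<lambda>y. c x + f y) (K x))) (\<lambda>z. z)
      = measure_pmf.expectation p (\<lambda>x. c x + measure_pmf.expectation (K x) f)"
    unfolding iter(3)
    by (rule integral_cong_AE) (simp_all add: AE_measure_pmf_iff E del: integral_map_pmf)
qed

subsection \<open>Splitting a trajectory at a time step\<close>

text \<open>The joint law of the reward of the first \<open>m\<close> transitions and the state \<open>s\<^sub>m\<^sub>+\<^sub>1\<close>.\<close>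

primrec past_law :: "('s, 'a) mdp \<Rightarrow> ('s, 'a) policy \<Rightarrow> nat \<Rightarrow> (real \<times> 's) pmf" where
  "past_law M \<pi> 0 = map_pmf (Pair 0) (init M)"
| "past_law M \<pi> (Suc m) = bind_pmf (past_law M \<pi> m) (\<lambda>(c, s).
     bind_pmf (\<pi> (Suc m) s) (\<lambda>a. map_pmf (\<lambda>s'. (c + reward M s a s', s')) (trans M s a)))"

lemma past_law_cong:
  "(\<And>i. i \<le> m \<Longrightarrow> \<pi> i = \<pi>' i) \<Longrightarrow> past_law M \<pi> m = past_law M \<pi>' m"
  by (induction m) auto

lemma run_cong:
  "(\<And>i. h \<le> i \<Longrightarrow> \<pi> i = \<pi>' i) \<Longrightarrow> run M \<pi> n h s = run M \<pi>' n h s"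
  by (induction n arbitrary: h s) simp_all

lemma total_reward_Cons: "total_reward M ((s, a, s') # \<tau>) = reward M s a s' + total_reward M \<tau>"
  by (simp add: total_reward_def)

lemma tail_law_eq_bind_action_tail_law:
  assumes "m < horizon M"
  shows "tail_law M \<pi> (Suc m) s = bind_pmf (\<pi> (Suc m) s) (action_tail_law M \<pi> (Suc m) s)"
proof -
  have "Suc (horizon M) - Suc m = Suc (Suc (horizon M) - Suc (Suc m))" using assms by simp
  then show ?thesis unfolding tail_law_def action_tail_law_def[abs_def] by simp
qed

text \<open>This is the Markov property at time \<open>Suc m\<close>. The remaining transitions are
  kept next to the total reward so that the induction can peel off one more of them.\<close>

lemma trajectory_split:
  assumes "m \<le> horizon M"
  shows "map_pmf (\<lambda>\<tau>. (total_reward M \<tau>, drop m \<tau>)) (trajectory M \<pi>)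
    = bind_pmf (past_law M \<pi> m) (\<lambda>(c, s).
        map_pmf (\<lambda>\<tau>. (c + total_reward M \<tau>, \<tau>)) (tail_law M \<pi> (Suc m) s))"
  using assms
proof (induction m)
  case 0
  then show ?case
    by (simp add: trajectory_def trajectory_from_def[abs_def] tail_law_def map_bind_pmf bind_map_pmf)
next
  case (Suc m)
  then have m: "m < horizon M" by simp
  have "map_pmf (\<lambda>\<tau>. (total_reward M \<tau>, drop (Suc m) \<tau>)) (trajectory M \<pi>)
    = map_pmf (apsnd tl) (map_pmf (\<lambda>\<tau>. (total_reward M \<tau>, drop m \<tau>)) (trajectory M \<pi>))"
    by (simp add: pmf.map_comp o_def drop_Suc drop_tl)
  also have "\<dots> = bind_pmf (past_law M \<pi> (Suc m)) (\<lambda>(c, s).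
        map_pmf (\<lambda>\<tau>. (c + total_reward M \<tau>, \<tau>)) (tail_law M \<pi> (Suc (Suc m)) s))"
    using Suc m
    by (simp add: tail_law_eq_bind_action_tail_law[OF m] action_tail_law_def case_prod_unfold
        map_bind_pmf bind_map_pmf bind_assoc_pmf pmf.map_comp o_def total_reward_Cons add.assoc)
  finally show ?case .
qed

text \<open>This is the common space over which the returns of both neighbouring policies are
  averaged.\<close>

definition past_action_law :: "('s, 'a) mdp \<Rightarrow> ('s, 'a) policy \<Rightarrow> nat \<Rightarrow> (real \<times> 's \<times> 'a) pmf" where
  "past_action_law M \<pi> m =
     bind_pmf (past_law M \<pi> m) (\<lambda>(c, s). map_pmf (\<lambda>a. (c, s, a)) (\<pi> (Suc m) s))"

lemma visit_eq_map_past_action_law: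
  assumes m: "m < horizon M"
  shows "bind_pmf (init M) (visit M \<pi> (Suc m)) = map_pmf snd (past_action_law M \<pi> m)"
proof -
  let ?sa = "\<lambda>\<tau> :: ('a, 'b) traj. (fst (hd \<tau>), fst (snd (hd \<tau>)))"
  have sa: "map_pmf ?sa (action_tail_law M \<pi> (Suc m) s a) = return_pmf (s, a)" for s a
    by (simp add: action_tail_law_def map_bind_pmf pmf.map_comp o_def map_pmf_const)
  have "bind_pmf (init M) (visit M \<pi> (Suc m))
      = map_pmf (\<lambda>\<tau>. (state_at \<tau> (Suc m), action_at \<tau> (Suc m))) (trajectory M \<pi>)"
    by (simp add: visit_def[abs_def] trajectory_def map_bind_pmf)
  also have "\<dots> = map_pmf (?sa \<circ> snd) (map_pmf (\<lambda>\<tau>. (total_reward M \<tau>, drop m \<tau>)) (trajectory M \<pi>))"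
    unfolding pmf.map_comp
    using m trajectory_nth[of "Suc m" M _ \<pi>]
    \<comment> \<open>Time \<open>Suc m\<close> is list position \<open>m\<close>, the head of what
      remains after dropping \<open>m\<close> transitions.\<close>
    by (intro map_pmf_cong) (simp_all add: state_at_def action_at_def)
  also have "\<dots> = bind_pmf (past_law M \<pi> m) (\<lambda>(c, s).
      bind_pmf (\<pi> (Suc m) s) (\<lambda>a. map_pmf ?sa (action_tail_law M \<pi> (Suc m) s a)))"
    using m by (simp add: trajectory_split tail_law_eq_bind_action_tail_law case_prod_unfold
        map_bind_pmf pmf.map_comp o_def)
  also have "\<dots> = map_pmf snd (past_action_law M \<pi> m)"
    unfolding sa by (simp add: past_action_law_def case_prod_unfold map_pmf_def bind_assoc_pmf bind_return_pmf)
  finally show ?thesis .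
qed

lemma total_reward_law_state:
  assumes m: "m < horizon M"
  shows "map_pmf (total_reward M) (trajectory M \<pi>) = bind_pmf (past_law M \<pi> m) (\<lambda>(c, s).
    map_pmf (\<lambda>\<tau>. c + total_reward M \<tau>) (tail_law M \<pi> (Suc m) s))"
proof -
  have "map_pmf (total_reward M) (trajectory M \<pi>)
      = map_pmf fst (map_pmf (\<lambda>\<tau>. (total_reward M \<tau>, drop m \<tau>)) (trajectory M \<pi>))"
    by (simp add: pmf.map_comp o_def)
  then show ?thesis
    using m by (simp add: trajectory_split case_prod_unfold map_bind_pmf pmf.map_comp o_def)
qed

subsection \<open>Changing the policy one step at a time\<close>

definition switch_policy :: "('s, 'a) policy \<Rightarrow> ('s, 'a) policy \<Rightarrow> nat \<Rightarrow> ('s, 'a) policy" where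
  "switch_policy \<pi> \<pi>' k i = (if i \<le> k then \<pi> i else \<pi>' i)"

lemma past_law_switch: "m \<le> k \<Longrightarrow> past_law M (switch_policy \<pi> \<pi>' k) m = past_law M \<pi> m"
  by (rule past_law_cong) (simp add: switch_policy_def)

lemma tail_law_switch: "k < h \<Longrightarrow> tail_law M (switch_policy \<pi> \<pi>' k) h s = tail_law M \<pi>' h s"
  unfolding tail_law_def by (rule run_cong) (simp add: switch_policy_def fun_eq_iff)

text \<open>At time \<open>Suc m\<close> this policy already follows \<pi>', so the action of \<pi>
  in \<open>past_action_law\<close> is drawn and then ignored.\<close>

lemma total_reward_law_switch_before:
  assumes "m < horizon M"
  shows "map_pmf (total_reward M) (trajectory M (switch_policy \<pi> \<pi>' m))
    = bind_pmf (past_action_law M \<pi> m) (\<lambda>x.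
        map_pmf (\<lambda>\<tau>. fst x + total_reward M \<tau>) (tail_law M \<pi>' (Suc m) (fst (snd x))))"
  by (simp add: total_reward_law_state[OF assms] past_law_switch tail_law_switch
      past_action_law_def case_prod_unfold bind_assoc_pmf bind_map_pmf)

text \<open>Now the action drawn by \<pi> is really taken, and \<pi>' governs only the times after
  \<open>Suc m\<close>.\<close>

lemma total_reward_law_switch_after:
  assumes "m < horizon M"
  shows "map_pmf (total_reward M) (trajectory M (switch_policy \<pi> \<pi>' (Suc m)))
    = bind_pmf (past_action_law M \<pi> m) (\<lambda>x. map_pmf (\<lambda>\<tau>. fst x + total_reward M \<tau>)
        (action_tail_law M \<pi>' (Suc m) (fst (snd x)) (snd (snd x))))"
proof -
  let ?\<rho> = "switch_policy \<pi> \<pi>' (Suc m)"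
  have "action_tail_law M ?\<rho> (Suc m) s a = action_tail_law M \<pi>' (Suc m) s a" for s a
    by (simp add: action_tail_law_def tail_law_switch)
  moreover have "?\<rho> (Suc m) = \<pi> (Suc m)" by (simp add: switch_policy_def fun_eq_iff)
  ultimately show ?thesis
    by (simp add: total_reward_law_state[OF assms] past_law_switch
        tail_law_eq_bind_action_tail_law[OF assms] past_action_law_def case_prod_unfold
        bind_assoc_pmf bind_map_pmf map_bind_pmf)
qed

lemma performance_eq_expectation_reward_law:
  "performance M \<rho> = measure_pmf.expectation (map_pmf (total_reward M) (trajectory M \<rho>)) (\<lambda>z. z)"
  by (simp add: performance_def)

lemma performance_switch_diff:
  fixes M :: "('s, 'a) mdp" and \<pi> \<pi>' :: "('s, 'a) policy"
  assumes int: "\<And>\<rho> :: ('s, 'a) policy. integrable (measure_pmf (trajectory M \<rho>)) (total_reward M)"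
    and m: "m < horizon M"
  shows "performance M (switch_policy \<pi> \<pi>' (Suc m)) - performance M (switch_policy \<pi> \<pi>' m)
    = measure_pmf.expectation (bind_pmf (init M) (visit M \<pi> (Suc m)))
        (\<lambda>(s, a). advantage M \<pi>' (Suc m) s a)"
proof -
  have "integrable (measure_pmf (map_pmf (total_reward M) (trajectory M \<rho>))) (\<lambda>z. z)"
    for \<rho> :: "('s, 'a) policy"
    using int[of \<rho>] by simp
  note after = expectation_bind_shift[OF this[of "switch_policy \<pi> \<pi>' (Suc m)",
        unfolded total_reward_law_switch_after[OF m]]]
    and before = expectation_bind_shift[OF this[of "switch_policy \<pi> \<pi>' m",
        unfolded total_reward_law_switch_before[OF m]]]
  show ?thesis
    unfolding performance_eq_expectation_reward_law
      total_reward_law_switch_after[OF m] total_reward_law_switch_before[OF m]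
      \<comment> \<open>The two expectations are merged into one integral first; the past reward
        then cancels pointwise.\<close>
      after(2) before(2) Bochner_Integration.integral_diff[OF after(1) before(1), symmetric]
      visit_eq_map_past_action_law[OF m] integral_map_pmf
    by (simp add: advantage_def action_value_def state_value_def case_prod_unfold)
qed

text \<open>The mixed policy still agrees with \<pi> at time 0, but runs start at time 1.\<close>

lemma performance_switch_0: "performance M (switch_policy \<pi> \<pi>' 0) = performance M \<pi>'"
proof -
  have "trajectory_from M (switch_policy \<pi> \<pi>' 0) = trajectory_from M \<pi>'"
    unfolding trajectory_from_def fun_eq_iff
    by (intro allI run_cong) (simp add: switch_policy_def fun_eq_iff)
  then show ?thesis by (simp add: performance_def trajectory_def)
qed

lemma performance_switch_horizon:
  "performance M (switch_policy \<pi> \<pi>' (horizon M)) = performance M \<pi>"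
proof -
  \<comment> \<open>The run consults the policy at times \<open>h\<close> to
    \<open>h + n - 1\<close> only, and the bound keeps these at most \<open>k\<close>.\<close>
  have "run M (switch_policy \<pi> \<pi>' k) n h s = run M \<pi> n h s" if "h + n \<le> Suc k" for k n h s
    using that by (induction n arbitrary: h s) (simp_all add: switch_policy_def)
  then have "trajectory_from M (switch_policy \<pi> \<pi>' (horizon M)) = trajectory_from M \<pi>"
    by (simp add: trajectory_from_def fun_eq_iff)
  then show ?thesis by (simp add: performance_def trajectory_def)
qed

theorem mainTheorem6:
  fixes M :: "('s, 'a) mdp" and \<pi> \<pi>' :: "('s, 'a) policy"
  assumes "\<And>\<rho> :: ('s, 'a) policy. integrable (measure_pmf (trajectory M \<rho>)) (total_reward M)"
  shows "performance M \<pi> - performance M \<pi>' =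
    (\<Sum>h = 1..horizon M.
      measure_pmf.expectation (bind_pmf (init M) (visit M \<pi> h))
        (\<lambda>(s\<^sub>h, a\<^sub>h). advantage M \<pi>' h s\<^sub>h a\<^sub>h))"
proof -
  let ?J = "\<lambda>k. performance M (switch_policy \<pi> \<pi>' k)"
  have "performance M \<pi> - performance M \<pi>' = ?J (horizon M) - ?J 0"
    by (simp add: performance_switch_0 performance_switch_horizon)
  also have "\<dots> = (\<Sum>m<horizon M. ?J (Suc m) - ?J m)"
    by (rule sum_lessThan_telescope[symmetric])
  also have "\<dots> = (\<Sum>m<horizon M.
      measure_pmf.expectation (bind_pmf (init M) (visit M \<pi> (Suc m)))
        (\<lambda>(s, a). advantage M \<pi>' (Suc m) s a))"
    by (intro sum.cong refl performance_switch_diff assms) simp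
  also have "\<dots> = (\<Sum>h = 1..horizon M.
      measure_pmf.expectation (bind_pmf (init M) (visit M \<pi> h))
        (\<lambda>(s, a). advantage M \<pi>' h s a))"
    using sum.atLeast1_atMost_eq[of "\<lambda>h. measure_pmf.expectation (bind_pmf (init M) (visit M \<pi> h))
        (\<lambda>(s, a). advantage M \<pi>' h s a)" "horizon M"] by simp
  finally show ?thesis .
qed

end
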